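(* Let $\Lambda_\Phi$ be a slicing self-affine sponge generated by the slicing self-affine IFS $\Phi=(\phi_{\mathbf a})_{\mathbf a\in\mathcal D}$ with digit set $\mathcal D$. If $\Lambda_\Phi$ possesses trivial points, then there exists a proper sub-IFS of an iteration of $\Phi$, with invariant set $\Lambda'$, such that the connected part of $\Lambda_\Phi$ is contained in $$\bigcup_{\omega\in\bigcup_{k\ge0}\mathcal D^k}\phi_\omega(\Lambda').$$
   Context: Slicing self-affine IFS. Fix $d\ge1$. For each $i\in\{1,\dots,d\}$ let $A_i=\{0,1,\dots,n_i-1\}$ with $n_i\ge 2$ an integer, and let $(\phi_{a,i})_{a\in A_i}$ be contracting similarities of $[0,1]$ into itself such that $[0,1)=\phi_{0,i}[0,1)\cup\cdots\cup\phi_{n_i-1,i}[0,1)$ is a partition of $[0,1)$ from left to right. For $\mathbf a=(a_1,\dots,a_d)\in A=\prod_{i=1}^d A_i$ put $\phi_{\mathbf a}(x_1,\dots,x_d)=(\phi_{a_1,1}(x_1),\dots,\phi_{a_d,d}(x_d))$. For $\mathcal D\subset A$ (the digit set), $\Phi=(\phi_{\mathbf a})_{\mathbf a\in\mathcal D}$ is called a slicing self-affine IFS, and its invariant set (attractor) $\Lambda_\Phi$, the unique nonempty compact set with $\Lambda_\Phi=\bigcup_{\mathbf a\in\mathcal D}\phi_{\mathbf a}(\Lambda_\Phi)$, is called a slicing self-affine sponge. For $\omega=\omega_1\dots\omega_k\in\mathcal D^k$, $\phi_\omega=\phi_{\omega_1}\circ\cdots\circ\phi_{\omega_k}$ (the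 identity if $k=0$). For $m\ge1$ the $m$-th iteration of $\Phi$ is the IFS $(\phi_\omega)_{\omega\in\mathcal D^m}$; a proper sub-IFS of it is an IFS $(\phi_\omega)_{\omega\in\mathcal D'}$ with $\mathcal D'\subsetneq\mathcal D^m$, and its invariant set is its attractor, i.e. the unique nonempty compact set $\Lambda'$ with $\Lambda'=\bigcup_{\omega\in\mathcal D'}\phi_\omega(\Lambda')$. A connected component of a set is trivial if it is a singleton; a trivial point of a set is a point whose connected component in that set is a singleton. The connected part of a metric space $X$ is the union of all its non-trivial connected components.
   Formalization: The digit set is assumed to have at least two elements; with a single digit the sponge is one trivial point and the only proper sub-IFS of any iteration is empty, which has no nonempty invariant set, so the claim fails there. *)

theory Defs
  imports "HOL-Analysis.Analysis"
begin

definition contracting_similarity_on :: "'a::metric_space set \<Rightarrow> ('a \<Rightarrow> 'a) \<Rightarrow> bool" where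
  "contracting_similarity_on X f \<longleftrightarrow>
     f ` X \<subseteq> X \<and> (\<exists>r. 0 < r \<and> r < 1 \<and> (\<forall>x\<in>X. \<forall>y\<in>X. dist (f x) (f y) = r * dist x y))"

text \<open>
  The map \<open>\<phi> a i\<close> is $\phi_{a,i}$; its values matter only on \<open>{0..1}\<close> and only for
  \<open>a < n i\<close>. The last conjunct says that the pieces are pairwise disjoint and ordered
  from left to right.
\<close>
definition slicing :: "('d \<Rightarrow> nat) \<Rightarrow> (nat \<Rightarrow> 'd \<Rightarrow> real \<Rightarrow> real) \<Rightarrow> bool" where
  "slicing n \<phi> \<longleftrightarrow>
     (\<forall>i. n i \<ge> 2 \<and>
        (\<forall>a<n i. contracting_similarity_on {0..1} (\<phi> a i)) \<and>
        {0..<1} = (\<Union>a<n i. \<phi> a i ` {0..<1}) \<and>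
        (\<forall>b<n i. \<forall>a<b. \<forall>x\<in>\<phi> a i ` {0..<1}. \<forall>y\<in>\<phi> b i ` {0..<1}. x < y))"

definition digits :: "('d::finite \<Rightarrow> nat) \<Rightarrow> (nat ^ 'd) set" where
  "digits n = {a. \<forall>i. a $ i < n i}"

definition slice_map ::
    "(nat \<Rightarrow> 'd::finite \<Rightarrow> real \<Rightarrow> real) \<Rightarrow> nat ^ 'd \<Rightarrow> real ^ 'd \<Rightarrow> real ^ 'd" where
  "slice_map \<phi> a x = (\<chi> i. \<phi> (a $ i) i (x $ i))"

primrec word_map ::
    "(nat \<Rightarrow> 'd::finite \<Rightarrow> real \<Rightarrow> real) \<Rightarrow> (nat ^ 'd) list \<Rightarrow> real ^ 'd \<Rightarrow> real ^ 'd" where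
  "word_map \<phi> [] = id"
| "word_map \<phi> (a # \<omega>) = slice_map \<phi> a \<circ> word_map \<phi> \<omega>"

definition words :: "'a set \<Rightarrow> nat \<Rightarrow> 'a list set" where
  "words D k = {\<omega>. length \<omega> = k \<and> set \<omega> \<subseteq> D}"

definition unit_cube :: "(real ^ 'd::finite) set" where
  "unit_cube = {x. \<forall>i. x $ i \<in> {0..1}}"

text \<open>
  The invariant set of the IFS \<open>(f \<omega>)\<^sub>\<omega>\<^sub>\<in>\<^sub>I\<close> on the unit cube. The maps are total functions that are
  constrained only on the cube, so invariant sets are taken inside it; there a finite nonempty
  family of contractions has exactly one.
\<close>
definition is_attractor ::
    "('w \<Rightarrow> real ^ 'd::finite \<Rightarrow> real ^ 'd) \<Rightarrow> 'w set \<Rightarrow> (real ^ 'd) set \<Rightarrow> bool" where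
  "is_attractor f I K \<longleftrightarrow>
     K \<subseteq> unit_cube \<and> compact K \<and> K \<noteq> {} \<and> K = (\<Union>\<omega>\<in>I. f \<omega> ` K)"

definition trivial_point :: "'a::topological_space set \<Rightarrow> 'a \<Rightarrow> bool" where
  "trivial_point S x \<longleftrightarrow> x \<in> S \<and> connected_component_set S x = {x}"

definition connected_part :: "'a::topological_space set \<Rightarrow> 'a set" where
  "connected_part S = \<Union>{C \<in> components S. \<not> is_singleton C}"

end

theory Submission
  imports Defs
begin

text \<open>
  \<^bold>\<open>Why the theorem holds.\<close> Suppose that some clopen piece \<open>U\<close> of the sponge \<open>\<Lambda>\<close> stays off the
  boundary of the cube. Every copy \<open>\<phi>\<^sub>\<omega>(U)\<close> is then clopen in \<open>\<Lambda>\<close>, because cylinders of equal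
  length meet only along their boundaries. A small cylinder, coded by a word \<open>\<sigma>\<close> of some length
  \<open>m\<close>, fits into \<open>U\<close>. A point whose coding in blocks of length \<open>m\<close> keeps returning to \<open>\<sigma>\<close> lies in
  clopen pieces \<open>\<phi>\<^sub>\<omega>(U)\<close> of arbitrarily small diameter, so it is trivial. All other points have
  the form \<open>\<phi>\<^sub>\<omega>(y)\<close> with \<open>y\<close> coded without \<open>\<sigma>\<close>, which means that \<open>y\<close> lies in the attractor of
  \<open>D\<^sup>m - {\<sigma>}\<close> (\<open>connected_part_covered\<close>).

  It remains to find \<open>U\<close>, and by the Sura-Bura theorem it suffices to find a trivial point off the
  boundary. Here a coordinate counts only if it is \<^emph>\<open>moving\<close>, that is, if the digits of \<open>D\<close> are not
  all equal in it: cylinders can meet only across moving coordinates. Take a trivial point \<open>x\<close> with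
  the least number of moving coordinates in \<open>{0, 1}\<close>, and let \<open>S\<close> be the set of these coordinates.
  A copy \<open>\<phi>\<^sub>\<omega>(x)\<close> in which some coordinate of \<open>S\<close> has left its face lies on fewer faces than \<open>x\<close>,
  so it is not trivial, so another cylinder of the same length passes through it
  (\<open>neighbour_exists\<close>). By \<open>cylinders_meet\<close> the word of this neighbour agrees with \<open>\<omega>\<close> in
  the coordinates outside \<open>S\<close> and lies one step closer to the faces of \<open>x\<close> in some of the
  coordinates of \<open>S\<close>. Passing from neighbour to neighbour gives a chain of intersecting
  cylinders that ends at the cylinder of \<open>x\<close>. If \<open>S\<close> is nonempty, one can start such a chain at a
  cylinder with a point at distance at least one from \<open>x\<close>. The cylinders can be chosen arbitrarily small,
  whereas a trivial point has a small clopen neighbourhood, which no chain of sufficiently small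
  intersecting cylinders leaves. Hence \<open>S\<close> is empty (\<open>bd_empty_if_minimal\<close>).
\<close>

section \<open>Contracting similarities that tile the unit interval\<close>

text \<open>On an interval a similarity is affine with slope \<open>r\<close> or \<open>- r\<close>: the distances of \<open>f x\<close>
  to \<open>f 0\<close> and to \<open>f 1\<close> leave no other position.\<close>

lemma similarity_interval_cases:
  fixes f :: "real \<Rightarrow> real"
  assumes "contracting_similarity_on {0..1} f"
  obtains r where "0 < r" "r < 1" "\<And>x. x \<in> {0..1} \<Longrightarrow> f x = f 0 + r * x"
  | r where "0 < r" "r < 1" "\<And>x. x \<in> {0..1} \<Longrightarrow> f x = f 0 - r * x"
proof -
  obtain r where r: "0 < r" "r < 1"
    and d: "\<And>x y. x \<in> {0..1} \<Longrightarrow> y \<in> {0..1} \<Longrightarrow> \<bar>f x - f y\<bar> = r * \<bar>x - y\<bar>"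
    using assms unfolding contracting_similarity_on_def dist_real_def by blast
  have x0: "\<bar>f x - f 0\<bar> = r * x" and x1: "\<bar>f 1 - f x\<bar> = r - r * x" if "x \<in> {0..1}" for x
    using d[of x 0] d[of 1 x] that by (auto simp: right_diff_distrib)
  have pos: "0 \<le> r * x" "r * x \<le> r" if "x \<in> {0..1}" for x
    using that r by (auto simp: mult_le_cancel_left1)
  have "\<bar>f 1 - f 0\<bar> = r" using x0[of 1] by simp
  then consider "f 1 = f 0 + r" | "f 1 = f 0 - r" by linarith
  then show thesis
  proof cases
    case 1
    have "f x = f 0 + r * x" if "x \<in> {0..1}" for x
      using 1 x0[OF that] x1[OF that] pos[OF that] by (auto simp: abs_if split: if_splits)
    with r show thesis by (rule that(1))
  next
    case 2
    have "f x = f 0 - r * x" if "x \<in> {0..1}" for x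
      using 2 x0[OF that] x1[OF that] pos[OF that] by (auto simp: abs_if split: if_splits)
    with r show thesis by (rule that(2))
  qed
qed

lemma slicing_similarity:
  assumes "slicing n \<phi>" "a < n i"
  shows "contracting_similarity_on {0..1} (\<phi> a i)"
proof -
  have "\<forall>a<n i. contracting_similarity_on {0..1} (\<phi> a i)"
    using assms(1) unfolding slicing_def by (elim allE[of _ i] conjE)
  with assms(2) show ?thesis by blast
qed

lemma slicing_cover:
  assumes "slicing n \<phi>"
  shows "{0..<1} = (\<Union>a<n i. \<phi> a i ` {0..<1})"
  using assms unfolding slicing_def by (elim allE[of _ i] conjE)

lemma slicing_piece_less:
  assumes "slicing n \<phi>" "a < b" "b < n i" "x \<in> {0..<1}" "y \<in> {0..<1}"
  shows "\<phi> a i x < \<phi> b i y"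
proof -
  have "\<forall>b<n i. \<forall>a<b. \<forall>x\<in>\<phi> a i ` {0..<1}. \<forall>y\<in>\<phi> b i ` {0..<1}. x < y"
    using assms(1) unfolding slicing_def by (elim allE[of _ i] conjE)
  with assms(2-) show ?thesis by blast
qed

lemma slicing_maps_unit:
  "slicing n \<phi> \<Longrightarrow> a < n i \<Longrightarrow> x \<in> {0..1} \<Longrightarrow> \<phi> a i x \<in> {0..1}"
  using slicing_similarity[of n \<phi> a i] unfolding contracting_similarity_on_def by blast

text \<open>No piece is reversed. The image of the half-open interval under a reversed map omits its
  left endpoint, so another piece contains this endpoint. By the ordering that piece lies to the
  left and has the endpoint as its maximum, hence it is reversed as well; an induction along
  the ordering excludes this.\<close>

lemma slicing_increasing_affine:
  assumes sl: "slicing n \<phi>" and "a < n i"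
  shows "\<exists>r. 0 < r \<and> r < 1 \<and> (\<forall>x\<in>{0..1}. \<phi> a i x = \<phi> a i 0 + r * x)"
  using \<open>a < n i\<close>
proof (induction a rule: less_induct)
  case (less a)
  note sim = slicing_similarity[OF sl] and cover = slicing_cover[OF sl, of i]
    and ord = slicing_piece_less[OF sl]
  from sim[OF less.prems] show ?case
  proof (cases rule: similarity_interval_cases)
    case (1 r)
    then show ?thesis by blast
  next
    case (2 r)
    let ?e = "\<phi> a i 1"
    have e: "?e = \<phi> a i 0 - r" using 2(3)[of 1] by simp
    have above: "?e < \<phi> a i s" if "s \<in> {0..<1}" for s
      using 2(1) 2(3)[of s] that by (auto simp: e)
    have "?e \<in> {0..1}"
      using slicing_maps_unit[OF sl less.prems, of 1] by simp
    moreover have "\<phi> a i 0 \<in> {0..<1}"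
      by (subst cover) (rule UN_I[of a], use less.prems in auto)
    ultimately have "?e \<in> {0..<1}" using above[of 0] by auto
    then have "?e \<in> (\<Union>b<n i. \<phi> b i ` {0..<1})" by (subst cover[symmetric])
    then obtain b s where b: "b < n i" and s: "s \<in> {0..<1}" and bs: "\<phi> b i s = ?e"
      by (elim UN_E imageE) simp
    have "b \<noteq> a" using above[OF s] bs by auto
    moreover have "\<not> a < b" using ord[of a b i 0 s] above[of 0] b s bs by auto
    ultimately have "b < a" by simp
    with less.IH[OF this b] obtain q where q: "0 < q" "q < 1"
      "\<And>x. x \<in> {0..1} \<Longrightarrow> \<phi> b i x = \<phi> b i 0 + q * x" by blast
    \<comment> \<open>an increasing \<open>\<phi> b i\<close> takes a value larger than the endpoint, by \<open>h\<close>\<close>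
    define u where "u = (s + 1) / 2"
    have u: "u \<in> {0..<1}" "s < u" using s by (auto simp: u_def)
    define h where "h = \<phi> b i u - ?e"
    have h: "h > 0" using q(1) q(3)[of u] q(3)[of s] u s bs by (auto simp: h_def)
    \<comment> \<open>a point of the reversed piece within \<open>h\<close> of its missing endpoint\<close>
    define t where "t = max 0 (1 - h / r)"
    have t: "t \<in> {0..<1}" using h 2(1) by (auto simp: t_def)
    have "\<phi> a i t \<le> ?e + h"
    proof -
      have "r * (1 - t) \<le> h" using 2(1) h
        by (auto simp: t_def max_def field_simps)
      then show ?thesis using 2(3)[of t] t by (simp add: e algebra_simps)
    qed
    moreover have "\<phi> b i u < \<phi> a i t" using ord[OF \<open>b < a\<close> less.prems] u t by auto
    ultimately show ?thesis by (simp add: h_def)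
  qed
qed

lemma slicing_strict_mono:
  assumes "slicing n \<phi>" "a < n i" "x \<in> {0..1}" "y \<in> {0..1}" "x < y"
  shows "\<phi> a i x < \<phi> a i y"
proof -
  obtain r where "0 < r" "\<And>x. x \<in> {0..1} \<Longrightarrow> \<phi> a i x = \<phi> a i 0 + r * x"
    using slicing_increasing_affine[OF assms(1,2)] by blast
  then show ?thesis using assms by (metis add_strict_left_mono mult_strict_left_mono)
qed

lemma slicing_piece_order:
  assumes sl: "slicing n \<phi>" and ab: "a < b" "b < n i"
  shows "\<phi> a i 1 \<le> \<phi> b i 0"
proof (rule dense_ge)
  fix z assume "\<phi> b i 0 < z"
  have *: "\<phi> a i s < \<phi> b i 0" if "s \<in> {0..<1}" for s
    using slicing_piece_less[OF sl ab that, of 0] by simp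
  obtain r where r: "0 < r" "\<And>x. x \<in> {0..1} \<Longrightarrow> \<phi> a i x = \<phi> a i 0 + r * x"
    using slicing_increasing_affine[OF sl] ab by (metis order.strict_trans)
  define h where "h = z - \<phi> b i 0"
  have h: "h > 0" using \<open>\<phi> b i 0 < z\<close> by (simp add: h_def)
  \<comment> \<open>the right end \<open>\<phi> a i 1\<close> is not covered by the ordering of the half-open pieces; \<open>t < 1\<close> has an
    image within \<open>h\<close> of it\<close>
  define t where "t = max 0 (1 - h / r)"
  have t: "t \<in> {0..<1}" using h r(1) by (auto simp: t_def)
  have "r * (1 - t) \<le> h" using r(1) h by (auto simp: t_def max_def field_simps)
  then have "\<phi> a i 1 \<le> \<phi> a i t + h" using r(2)[of t] r(2)[of 1] t by (simp add: algebra_simps)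
  with *[OF t] show "\<phi> a i 1 \<le> z" by (simp add: h_def)
qed

section \<open>Compositions along one coordinate\<close>

abbreviation coord_map :: "(nat \<Rightarrow> 'd \<Rightarrow> real \<Rightarrow> real) \<Rightarrow> 'd \<Rightarrow> nat list \<Rightarrow> real \<Rightarrow> real" where
  "coord_map \<phi> i u \<equiv> foldr (\<lambda>a. \<phi> a i) u"

lemma coord_map_unit:
  assumes "slicing n \<phi>" "set u \<subseteq> {..<n i}" "x \<in> {0..1}"
  shows "coord_map \<phi> i u x \<in> {0..1}"
  using assms(2)
proof (induction u)
  case (Cons a u)
  then show ?case using slicing_maps_unit[OF assms(1), of a i] by simp
qed (use assms in simp)

lemma coord_map_strict_mono:
  assumes "slicing n \<phi>" "set u \<subseteq> {..<n i}" "x \<in> {0..1}" "y \<in> {0..1}" "x < y"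
  shows "coord_map \<phi> i u x < coord_map \<phi> i u y"
  using assms(2)
proof (induction u)
  case (Cons a u)
  then have "a < n i" "set u \<subseteq> {..<n i}" by auto
  then show ?case
    using slicing_strict_mono[OF assms(1) _ coord_map_unit[OF assms(1) _ assms(3)]
        coord_map_unit[OF assms(1) _ assms(4)] Cons.IH]
    by simp
qed (use assms in simp)

lemma coord_map_inj:
  assumes "slicing n \<phi>" "set u \<subseteq> {..<n i}" "x \<in> {0..1}" "y \<in> {0..1}"
    "coord_map \<phi> i u x = coord_map \<phi> i u y"
  shows "x = y"
  using coord_map_strict_mono[OF assms(1,2,3,4)] coord_map_strict_mono[OF assms(1,2,4,3)] assms(5)
  by linarith

lemma coord_map_endpoint:
  assumes "slicing n \<phi>" "set u \<subseteq> {..<n i}" "x \<in> {0..1}" "e \<in> {0, 1}" "coord_map \<phi> i u x = e"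
  shows "x = e"
proof (rule ccontr)
  assume "x \<noteq> e"
  then show False
    using coord_map_strict_mono[OF assms(1,2), of x e] coord_map_strict_mono[OF assms(1,2), of e x]
      coord_map_unit[OF assms(1,2), of e] assms by (auto simp: not_less)
qed

text \<open>Different words of equal length code intervals without common interior points, so two of
  them can only meet right end to left end. After a common prefix is cancelled, the first
  differing letters force the two remaining points to be the endpoints \<open>0\<close> and \<open>1\<close>, and
  endpoints are only attained at endpoints.\<close>

lemma coord_map_meet:
  assumes sl: "slicing n \<phi>"
    and "length u = length v" "set u \<subseteq> {..<n i}" "set v \<subseteq> {..<n i}"
    and x: "x \<in> {0..1}" and y: "y \<in> {0..1}"
    and "coord_map \<phi> i u x = coord_map \<phi> i v y" "u \<noteq> v"
  shows "x \<in> {0, 1} \<and> y = 1 - x"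
  using assms(2-4,7,8)
proof (induction u v rule: list_induct2)
  case (Cons a u b v)
  let ?X = "coord_map \<phi> i u x" and ?Y = "coord_map \<phi> i v y"
  have ab: "a < n i" "b < n i" and uv: "set u \<subseteq> {..<n i}" "set v \<subseteq> {..<n i}"
    using Cons.prems by auto
  have X: "?X \<in> {0..1}" and Y: "?Y \<in> {0..1}"
    using coord_map_unit[OF sl] uv x y by blast+
  have eq: "\<phi> a i ?X = \<phi> b i ?Y" using Cons.prems by simp
  have ends: "X' = 1 \<and> Y' = 0"
    if "c < d" "d < n i" "X' \<in> {0..1}" "Y' \<in> {0..1}" "\<phi> c i X' = \<phi> d i Y'" for c d X' Y'
  proof -
    have "c < n i" using that by simp
    then have "X' < 1 \<Longrightarrow> \<phi> c i X' < \<phi> c i 1" "0 < Y' \<Longrightarrow> \<phi> d i 0 < \<phi> d i Y'"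
      using slicing_strict_mono[OF sl, of c i X' 1] slicing_strict_mono[OF sl, of d i 0 Y'] that
      by auto
    then show ?thesis using slicing_piece_order[OF sl that(1,2)] that
      by (cases "X' < 1"; cases "0 < Y'") auto
  qed
  consider "a = b" | "a < b" | "b < a" by linarith
  then show ?case
  proof cases
    case 1
    then have "?X = ?Y"
      using slicing_strict_mono[OF sl ab(1) X Y] slicing_strict_mono[OF sl ab(1) Y X] eq
      by (metis linorder_neqE_linordered_idom order_less_irrefl)
    then show ?thesis using Cons.IH uv Cons.prems 1 by auto
  next
    case 2
    from ends[OF 2 ab(2) X Y eq] have "?X = 1" "?Y = 0" by auto
    then show ?thesis
      using coord_map_endpoint[OF sl uv(1) x, of 1] coord_map_endpoint[OF sl uv(2) y, of 0] by auto
  next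
    case 3
    from ends[OF 3 ab(1) Y X eq[symmetric]] have "?X = 0" "?Y = 1" by auto
    then show ?thesis
      using coord_map_endpoint[OF sl uv(1) x, of 0] coord_map_endpoint[OF sl uv(2) y, of 1] by auto
  qed
qed simp

section \<open>Trivial points and clopen pieces\<close>

definition clopen_piece :: "'a::metric_space set \<Rightarrow> 'a set \<Rightarrow> bool" where
  "clopen_piece S U \<longleftrightarrow> U \<subseteq> S \<and> compact U \<and> compact (S - U)"

text \<open>In a compact set, components are intersections of clopen sets (Sura-Bura).\<close>

lemma trivial_point_iff_clopen:
  fixes S :: "'a::euclidean_space set"
  assumes "compact S"
  shows "trivial_point S x \<longleftrightarrow>
    x \<in> S \<and> (\<forall>V. open V \<and> x \<in> V \<longrightarrow> (\<exists>U. clopen_piece S U \<and> x \<in> U \<and> U \<subseteq> V))"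
    (is "_ \<longleftrightarrow> _ \<and> ?R")
proof (intro iffI conjI allI impI)
  assume t: "trivial_point S x"
  then show "x \<in> S" by (simp add: trivial_point_def)
  fix V assume V: "open V \<and> x \<in> V"
  have "{x} \<in> components S" using t by (metis componentsI trivial_point_def)
  then obtain K where K: "openin (top_of_set S) K" "compact K" "{x} \<subseteq> K" "K \<subseteq> V"
    using Sura_Bura_clopen_subset[of S "{x}" V] assms V closed_imp_locally_compact
      compact_imp_closed by auto
  have "closedin (top_of_set S) (S - K)" using K(1) by (simp add: closedin_diff)
  then have "compact (S - K)" using assms closedin_compact by blast
  moreover have "K \<subseteq> S" using K(1) openin_imp_subset by blast
  ultimately show "\<exists>U. clopen_piece S U \<and> x \<in> U \<and> U \<subseteq> V"
    using K by (auto simp: clopen_piece_def)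
next
  assume R: "x \<in> S \<and> ?R"
  have "y = x" if y: "connected_component S x y" for y
  proof (rule ccontr)
    assume "y \<noteq> x"
    then obtain U where U: "clopen_piece S U" "x \<in> U" "U \<subseteq> - {y}"
      using R by (metis ComplI open_delete open_UNIV Compl_eq_Diff_UNIV singletonD)
    obtain T where T: "connected T" "T \<subseteq> S" "x \<in> T" "y \<in> T"
      using y by (auto simp: connected_component_def)
    have "closed U" "closed (S - U)" "T \<subseteq> U \<union> (S - U)"
      using U T by (auto simp: clopen_piece_def compact_imp_closed)
    then have "U \<inter> T = {} \<or> (S - U) \<inter> T = {}"
      using T(1) U by (intro connected_closedD) auto
    then show False using U T by blast
  qed
  then show "trivial_point S x"
    using R by (auto simp: trivial_point_def)
qed

lemma clopen_piece_separated:
  fixes S :: "'a::euclidean_space set"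
  assumes "clopen_piece S U"
  obtains e where "0 < e" "\<And>x y. x \<in> U \<Longrightarrow> y \<in> S \<Longrightarrow> dist x y < e \<Longrightarrow> y \<in> U"
proof -
  obtain e where e: "e > 0" "\<forall>x\<in>U. \<forall>y\<in>S - U. e \<le> dist x y"
    using separate_compact_closed[of U "S - U"] assms
    by (auto simp: clopen_piece_def compact_imp_closed)
  show thesis
  proof (rule that[OF e(1)])
    fix x y assume "x \<in> U" "y \<in> S" "dist x y < e"
    then show "y \<in> U" using e(2) by force
  qed
qed

section \<open>Attractors of injective systems\<close>

definition hutchinson :: "('w \<Rightarrow> 'a \<Rightarrow> 'a) \<Rightarrow> 'w set \<Rightarrow> 'a set \<Rightarrow> 'a set" where
  "hutchinson f I K = (\<Union>\<omega>\<in>I. f \<omega> ` K)"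

lemma compact_unit_cube: "compact (unit_cube :: (real ^ 'd::finite) set)"
proof -
  have "unit_cube = cbox (0 :: real ^ 'd) (\<chi> i. 1)"
    by (auto simp: unit_cube_def mem_box_cart)
  show ?thesis unfolding \<open>unit_cube = _\<close> by (rule compact_cbox)
qed

text \<open>A finite system of continuous injections of the cube has an invariant set, the limit of the
  iterated images of the cube. Injectivity gives invariance of this limit: some single map
  sends a point of infinitely many iterates to a given limit point, and its only preimage
  lies in all of them.\<close>

lemma is_attractor_Inter_iterates:
  fixes f :: "'w \<Rightarrow> real ^ 'd::finite \<Rightarrow> real ^ 'd"
  assumes "finite I" "I \<noteq> {}"
    and cont: "\<And>\<omega>. \<omega> \<in> I \<Longrightarrow> continuous_on unit_cube (f \<omega>)"
    and inj: "\<And>\<omega>. \<omega> \<in> I \<Longrightarrow> inj_on (f \<omega>) unit_cube"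
    and maps: "\<And>\<omega>. \<omega> \<in> I \<Longrightarrow> f \<omega> ` unit_cube \<subseteq> unit_cube"
  shows "is_attractor f I (\<Inter>k. (hutchinson f I ^^ k) unit_cube)"
proof -
  let ?K = "\<lambda>k. (hutchinson f I ^^ k) unit_cube"
  have K_Suc: "?K (Suc k) = (\<Union>\<omega>\<in>I. f \<omega> ` ?K k)" for k
    by (simp only: funpow.simps comp_apply hutchinson_def[of f I "(hutchinson f I ^^ k) unit_cube"])
  have mono: "hutchinson f I A \<subseteq> hutchinson f I B" if "A \<subseteq> B" for A B
    using that by (fastforce simp: hutchinson_def)
  have step: "?K (Suc k) \<subseteq> ?K k" for k
  proof (induction k)
    case 0
    then show ?case using maps by (auto simp: hutchinson_def)
  next
    case (Suc k)
    then show ?case using mono by simp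
  qed
  then have dec: "?K l \<subseteq> ?K k" if "k \<le> l" for k l
    using that by (rule lift_Suc_antimono_le)
  have sub: "?K k \<subseteq> unit_cube" for k using dec[of 0 k] by simp
  have comp: "compact (?K k)" for k
  proof (induction k)
    case (Suc k)
    have "compact (f \<omega> ` ?K k)" if "\<omega> \<in> I" for \<omega>
      using Suc compact_continuous_image continuous_on_subset[OF cont[OF that] sub] by blast
    then show ?case unfolding K_Suc using \<open>finite I\<close> by (intro compact_UN) auto
  qed (simp add: compact_unit_cube)
  have ne: "?K k \<noteq> {}" for k
  proof (induction k)
    case 0
    have "0 \<in> (unit_cube :: (real ^ 'd) set)" by (simp add: unit_cube_def)
    then show ?case by auto
  next
    case (Suc k)
    then show ?case unfolding K_Suc using \<open>I \<noteq> {}\<close> by blast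
  qed
  have "(\<Inter>k. ?K k) \<noteq> {}" using compact_nest[of ?K, OF comp ne dec] by simp
  moreover have "compact (\<Inter>k. ?K k)" using comp by (intro compact_Inter) auto
  moreover have "(\<Inter>k. ?K k) \<subseteq> unit_cube" using sub by blast
  moreover have "(\<Inter>k. ?K k) = (\<Union>\<omega>\<in>I. f \<omega> ` (\<Inter>k. ?K k))"
  proof (intro equalityI subsetI)
    fix x assume "x \<in> (\<Union>\<omega>\<in>I. f \<omega> ` (\<Inter>k. ?K k))"
    then obtain \<omega> y where \<omega>: "\<omega> \<in> I" "x = f \<omega> y" "\<And>k. y \<in> ?K k" by blast
    then have "x \<in> ?K (Suc k)" for k unfolding K_Suc by blast
    then show "x \<in> (\<Inter>k. ?K k)" using step by blast
  next
    fix x assume x: "x \<in> (\<Inter>k. ?K k)"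
    have "\<exists>\<omega>\<in>I. x \<in> f \<omega> ` ?K k" for k
    proof -
      have "x \<in> ?K (Suc k)" using x by blast
      then show ?thesis unfolding K_Suc by blast
    qed
    then obtain w where w: "\<And>k. w k \<in> I" "\<And>k. x \<in> f (w k) ` ?K k" by metis
    have "finite (range w)" using w(1) \<open>finite I\<close> by (metis finite_subset image_subsetI)
    then obtain l where "infinite {k \<in> UNIV. w k = w l}"
      using pigeonhole_infinite[OF infinite_UNIV_nat] by blast
    then obtain \<omega> where \<omega>: "\<omega> \<in> I" and inf: "infinite {k. w k = \<omega>}"
      using w(1)[of l] by simp
    have all: "x \<in> f \<omega> ` ?K k" for k
    proof -
      obtain l where l: "l \<ge> k" "w l = \<omega>" using inf unfolding infinite_nat_iff_unbounded_le by blast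
      then have "x \<in> f \<omega> ` ?K l" using w(2)[of l] by simp
      then show ?thesis using dec[OF l(1)] by blast
    qed
    obtain y where y: "x = f \<omega> y" "y \<in> unit_cube" using all[of 0] sub[of 0] by blast
    have "y \<in> ?K k" for k
    proof -
      obtain z where z: "z \<in> ?K k" "x = f \<omega> z" using all[of k] by blast
      then show ?thesis using inj_onD[OF inj[OF \<omega>], of y z] y sub[of k] by auto
    qed
    then show "x \<in> (\<Union>\<omega>\<in>I. f \<omega> ` (\<Inter>k. ?K k))" using \<omega> y(1) by blast
  qed
  ultimately show ?thesis by (simp add: is_attractor_def)
qed

section \<open>Words acting on the sponge\<close>

locale slicing_sponge =
  fixes n :: "'d::finite \<Rightarrow> nat" and \<phi> :: "nat \<Rightarrow> 'd \<Rightarrow> real \<Rightarrow> real"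
    and D :: "(nat ^ 'd) set" and \<Lambda> :: "(real ^ 'd) set"
  assumes slicing: "slicing n \<phi>" and digits: "D \<subseteq> digits n" and finite_D: "finite D"
    and attractor: "is_attractor (slice_map \<phi>) D \<Lambda>"
begin

abbreviation coord_word :: "'d \<Rightarrow> (nat ^ 'd) list \<Rightarrow> nat list" where
  "coord_word i \<equiv> map (\<lambda>a. a $ i)"

abbreviation W :: "(nat ^ 'd) list \<Rightarrow> real ^ 'd \<Rightarrow> real ^ 'd" where
  "W \<equiv> word_map \<phi>"

lemma \<Lambda>_unit: "x \<in> \<Lambda> \<Longrightarrow> x $ i \<in> {0..1}"
  using attractor unfolding is_attractor_def unit_cube_def by blast

lemma \<Lambda>_cube: "\<Lambda> \<subseteq> unit_cube" and compact_\<Lambda>: "compact \<Lambda>"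
  using attractor by (simp_all add: is_attractor_def)

lemma word_map_nth: "W \<omega> x $ i = coord_map \<phi> i (coord_word i \<omega>) (x $ i)"
  by (induction \<omega>) (simp_all add: slice_map_def)

lemma word_map_append: "W (u @ v) x = W u (W v x)"
  by (induction u) simp_all

lemma coord_word_letters: "\<omega> \<in> words D k \<Longrightarrow> set (coord_word i \<omega>) \<subseteq> {..<n i}"
  using digits by (auto simp: words_def digits_def)

lemma words_append: "u \<in> words D j \<Longrightarrow> v \<in> words D k \<Longrightarrow> u @ v \<in> words D (j + k)"
  by (auto simp: words_def)

lemma words_Cons: "a # u \<in> words D (Suc k) \<longleftrightarrow> a \<in> D \<and> u \<in> words D k"
  by (auto simp: words_def)

lemma finite_words: "finite (words D k)"
  using finite_lists_length_eq[OF finite_D, of k] by (simp add: words_def conj_commute)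

lemma words_eqI: "(\<And>i. coord_word i u = coord_word i v) \<Longrightarrow> u = v"
proof (induction u arbitrary: v)
  case Nil
  then show ?case by simp
next
  case (Cons a u)
  have "\<exists>b v'. v = b # v'" using Cons.prems by (metis list.map_disc_iff neq_Nil_conv)
  then obtain b v' where v: "v = b # v'" by blast
  have "a = b" using Cons.prems v by (simp add: vec_eq_iff)
  moreover have "u = v'" using Cons.prems v by (intro Cons.IH) simp
  ultimately show ?case using v by simp
qed

lemma \<Lambda>_words: "\<Lambda> = (\<Union>\<omega>\<in>words D k. W \<omega> ` \<Lambda>)"
proof (induction k)
  case 0
  have "words D 0 = {[]}" by (auto simp: words_def)
  then show ?case by simp
next
  case (Suc k)
  have "words D (Suc k) = (\<Union>a\<in>D. (#) a ` words D k)"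
    by (auto simp: words_def length_Suc_conv)
  then have "(\<Union>\<omega>\<in>words D (Suc k). W \<omega> ` \<Lambda>) = (\<Union>a\<in>D. slice_map \<phi> a ` (\<Union>\<omega>\<in>words D k. W \<omega> ` \<Lambda>))"
    by (auto simp: image_iff)
  also have "\<dots> = \<Lambda>" unfolding Suc[symmetric] using attractor by (simp add: is_attractor_def)
  finally show ?case by simp
qed

lemma word_map_in_\<Lambda>: "\<omega> \<in> words D k \<Longrightarrow> x \<in> \<Lambda> \<Longrightarrow> W \<omega> x \<in> \<Lambda>"
  using \<Lambda>_words[of k] by blast

lemma \<Lambda>_word_cases:
  assumes "x \<in> \<Lambda>"
  obtains \<omega> y where "\<omega> \<in> words D k" "y \<in> \<Lambda>" "x = W \<omega> y"
  using assms \<Lambda>_words[of k] by blast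

lemma word_map_cube: "\<omega> \<in> words D k \<Longrightarrow> W \<omega> ` unit_cube \<subseteq> unit_cube"
  using coord_map_unit[OF slicing coord_word_letters] by (auto simp: unit_cube_def word_map_nth)

lemma word_map_inj: "\<omega> \<in> words D k \<Longrightarrow> inj_on (W \<omega>) unit_cube"
proof (rule inj_onI)
  fix x y assume *: "\<omega> \<in> words D k" "x \<in> unit_cube" "y \<in> unit_cube" "W \<omega> x = W \<omega> y"
  have "x $ i = y $ i" for i
    using coord_map_inj[OF slicing coord_word_letters[OF *(1)], of "x $ i" "y $ i" i] *(2-4)
    by (simp add: word_map_nth[symmetric] unit_cube_def)
  then show "x = y" by (simp add: vec_eq_iff)
qed

lemma contraction:
  "\<exists>c. 0 \<le> c \<and> c < 1 \<and> (\<forall>k. \<forall>\<omega>\<in>words D k. \<forall>x\<in>unit_cube. \<forall>y\<in>unit_cube.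
    dist (W \<omega> x) (W \<omega> y) \<le> c ^ k * dist x y)"
proof -
  have "\<exists>r. 0 < r \<and> r < 1 \<and> (\<forall>x\<in>{0..1}. \<phi> (a $ i) i x = \<phi> (a $ i) i 0 + r * x)"
    if "a \<in> D" for a i
    using that digits by (intro slicing_increasing_affine[OF slicing]) (auto simp: digits_def)
  then obtain r where r: "\<And>a i. a \<in> D \<Longrightarrow> 0 < r a i" "\<And>a i. a \<in> D \<Longrightarrow> r a i < 1"
    "\<And>a i x. a \<in> D \<Longrightarrow> x \<in> {0..1} \<Longrightarrow> \<phi> (a $ i) i x = \<phi> (a $ i) i 0 + r a i * x"
    by metis
  let ?R = "insert 0 ((\<lambda>(a, i). r a i) ` (D \<times> UNIV))"
  define c where "c = Max ?R"
  have fin: "finite ?R" using finite_D by simp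
  have c: "0 \<le> c" "c < 1" unfolding c_def using fin r(2) by auto
  have rc: "r a i \<le> c" if "a \<in> D" for a i
    unfolding c_def using fin that by (intro Max_ge) auto
  have one: "dist (slice_map \<phi> a x) (slice_map \<phi> a y) \<le> c * dist x y"
    if "a \<in> D" "x \<in> unit_cube" "y \<in> unit_cube" for a x y
  proof -
    have "norm ((slice_map \<phi> a x - slice_map \<phi> a y) $ i) \<le> norm ((c *\<^sub>R (x - y)) $ i)" for i
    proof -
      have xy: "x $ i \<in> {0..1}" "y $ i \<in> {0..1}" using that by (auto simp: unit_cube_def)
      have "(slice_map \<phi> a x - slice_map \<phi> a y) $ i = r a i * (x $ i - y $ i)"
        using r(3)[OF that(1) xy(1)] r(3)[OF that(1) xy(2)]
        by (simp add: slice_map_def right_diff_distrib)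
      then show ?thesis using rc[OF that(1), of i] r(1)[OF that(1), of i] c
        by (simp add: abs_mult mult_right_mono)
    qed
    from norm_le_componentwise_cart[OF this] show ?thesis using c by (simp add: dist_norm)
  qed
  show ?thesis
  proof (intro exI[of _ c] conjI c allI ballI)
    fix k \<omega> and x y :: "real ^ 'd"
    assume "\<omega> \<in> words D k" and xy: "x \<in> unit_cube" "y \<in> unit_cube"
    then show "dist (W \<omega> x) (W \<omega> y) \<le> c ^ k * dist x y"
    proof (induction \<omega> arbitrary: k)
      case Nil
      then show ?case by (simp add: words_def)
    next
      case (Cons a \<omega>)
      then obtain l where l: "k = Suc l" "a \<in> D" "\<omega> \<in> words D l"
        by (cases k) (auto simp: words_def)
      have "dist (W (a # \<omega>) x) (W (a # \<omega>) y) \<le> c * dist (W \<omega> x) (W \<omega> y)"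
        using one[OF l(2)] word_map_cube[OF l(3)] xy by auto
      also have "\<dots> \<le> c * (c ^ l * dist x y)"
        using Cons.IH[OF l(3) xy] c by (intro mult_left_mono) auto
      finally show ?case by (simp add: l mult.assoc)
    qed
  qed
qed

lemma word_map_continuous: 
  assumes "\<omega> \<in> words D k" 
  shows "continuous_on unit_cube (W \<omega>)"
proof -
  obtain c where c: "0 \<le> c" "\<And>x y. x \<in> unit_cube \<Longrightarrow> y \<in> unit_cube \<Longrightarrow>
      dist (W \<omega> x) (W \<omega> y) \<le> c ^ k * dist x y"
    using contraction assms by blast
  then have "(c ^ k)-lipschitz_on unit_cube (W \<omega>)" by (intro lipschitz_onI) auto
  then show ?thesis by (rule lipschitz_on_continuous_on)
qed

lemma compact_image: 
  "\<omega> \<in> words D k \<Longrightarrow> compact K \<Longrightarrow> K \<subseteq> unit_cube \<Longrightarrow> compact (W \<omega> ` K)"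
  by (meson compact_continuous_image continuous_on_subset word_map_continuous)

lemma small_cylinders:
  assumes "0 < e"
  obtains N where "\<And>k \<omega> x y. N \<le> k \<Longrightarrow> \<omega> \<in> words D k \<Longrightarrow> x \<in> \<Lambda> \<Longrightarrow> y \<in> \<Lambda> \<Longrightarrow>
    dist (W \<omega> x) (W \<omega> y) < e"
proof -
  obtain c where c: "0 \<le> c" "c < 1"
    "\<And>k \<omega> x y. \<omega> \<in> words D k \<Longrightarrow> x \<in> unit_cube \<Longrightarrow> y \<in> unit_cube \<Longrightarrow>
      dist (W \<omega> x) (W \<omega> y) \<le> c ^ k * dist x y"
    using contraction by blast
  obtain b where b: "\<And>x y. x \<in> \<Lambda> \<Longrightarrow> y \<in> \<Lambda> \<Longrightarrow> dist x y \<le> b"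
    using compact_imp_bounded[OF compact_\<Lambda>] unfolding bounded_two_points by blast
  define B where "B = max b 1"
  have B: "0 < B" "\<And>x y. x \<in> \<Lambda> \<Longrightarrow> y \<in> \<Lambda> \<Longrightarrow> dist x y \<le> B"
    using b by (auto simp: B_def le_max_iff_disj)
  obtain N where N: "c ^ N < e / B" using real_arch_pow_inv[of "e / B" c] c assms B by auto
  show thesis
  proof (rule that)
    fix k \<omega> x y assume *: "N \<le> k" "\<omega> \<in> words D k" "x \<in> \<Lambda>" "y \<in> \<Lambda>"
    have "dist (W \<omega> x) (W \<omega> y) \<le> c ^ k * dist x y" using c(3) * \<Lambda>_cube by blast
    also have "\<dots> \<le> c ^ N * B" using * B c by (intro mult_mono power_decreasing) auto
    also have "\<dots> < e" using N B(1) by (simp add: field_simps)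
    finally show "dist (W \<omega> x) (W \<omega> y) < e" .
  qed
qed

section \<open>How cylinders meet\<close>

definition moving :: "'d set" where
  "moving = {i. \<exists>a\<in>D. \<exists>b\<in>D. a $ i \<noteq> b $ i}"

text \<open>Only the moving coordinates count for the boundary: the sponge may lie in a face of the
  cube, and different cylinders never meet across such a face.\<close>

definition bd :: "real ^ 'd \<Rightarrow> 'd set" where
  "bd x = {i \<in> moving. x $ i \<in> {0, 1}}"

text \<open>The rule for single coordinates, read in the cube: where the two words differ, the common
  point is an endpoint of one interval and the opposite endpoint of the other.\<close>

lemma cylinders_meet:
  assumes "\<omega> \<in> words D k" "\<tau> \<in> words D k" "x \<in> \<Lambda>" "y \<in> \<Lambda>" "W \<omega> x = W \<tau> y"
    and diff: "coord_word i \<omega> \<noteq> coord_word i \<tau>"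
  shows "i \<in> bd x" "y $ i = 1 - x $ i"
proof -
  have len: "length \<omega> = length \<tau>" using assms by (simp add: words_def)
  have eq: "coord_map \<phi> i (coord_word i \<omega>) (x $ i) = coord_map \<phi> i (coord_word i \<tau>) (y $ i)"
    using assms(5) by (metis word_map_nth)
  have *: "x $ i \<in> {0, 1} \<and> y $ i = 1 - x $ i"
    by (rule coord_map_meet[OF slicing _ coord_word_letters[OF assms(1)]
          coord_word_letters[OF assms(2)] \<Lambda>_unit[OF assms(3)] \<Lambda>_unit[OF assms(4)] eq diff])
      (simp add: len)
  obtain j where j: "j < length \<omega>" "(\<omega> ! j) $ i \<noteq> (\<tau> ! j) $ i"
    using diff len by (auto simp: list_eq_iff_nth_eq)
  have "\<omega> ! j \<in> D" "\<tau> ! j \<in> D"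
    using assms(1,2) j(1) len nth_mem[of j \<omega>] nth_mem[of j \<tau>] by (auto simp: words_def)
  then have "i \<in> moving" using j(2) unfolding moving_def by blast
  with * show "i \<in> bd x" "y $ i = 1 - x $ i" by (auto simp: bd_def)
qed

text \<open>A cylinder reaches a face of the cube only with its own face on the same side.\<close>

lemma bd_word_map:
  assumes "\<omega> \<in> words D k" "x \<in> \<Lambda>" "i \<in> bd (W \<omega> x)"
  shows "i \<in> bd x" "W \<omega> x $ i = x $ i"
proof -
  have e: "W \<omega> x $ i \<in> {0, 1}" "i \<in> moving" using assms(3) by (auto simp: bd_def)
  have "x $ i = W \<omega> x $ i"
    using coord_map_endpoint[OF slicing coord_word_letters[OF assms(1)] \<Lambda>_unit[OF assms(2)] e(1)]
    by (simp add: word_map_nth)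
  with e show "i \<in> bd x" "W \<omega> x $ i = x $ i" by (auto simp: bd_def)
qed

lemma compact_other_cylinders: "compact (\<Union>\<tau>\<in>words D k - {\<omega>}. W \<tau> ` \<Lambda>)"
  using finite_words compact_image[OF _ compact_\<Lambda> \<Lambda>_cube] by (intro compact_UN) auto

text \<open>The rest of \<open>\<Lambda>\<close> consists of the compact copy of \<open>\<Lambda> - U\<close> in the same cylinder and of the other
  cylinders of this length, finitely many compact sets.\<close>

lemma clopen_piece_word_map:
  assumes \<omega>: "\<omega> \<in> words D k" and U: "clopen_piece \<Lambda> U"
    and disj: "\<And>\<tau>. \<tau> \<in> words D k \<Longrightarrow> \<tau> \<noteq> \<omega> \<Longrightarrow> W \<omega> ` U \<inter> W \<tau> ` \<Lambda> = {}"
  shows "clopen_piece \<Lambda> (W \<omega> ` U)"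
proof -
  have U': "U \<subseteq> \<Lambda>" "compact U" "compact (\<Lambda> - U)" using U by (auto simp: clopen_piece_def)
  have "\<Lambda> - W \<omega> ` U = W \<omega> ` (\<Lambda> - U) \<union> (\<Union>\<tau>\<in>words D k - {\<omega>}. W \<tau> ` \<Lambda>)" (is "_ = ?A \<union> ?B")
  proof (intro equalityI subsetI)
    fix x assume x: "x \<in> \<Lambda> - W \<omega> ` U"
    then obtain \<tau> y where "\<tau> \<in> words D k" "y \<in> \<Lambda>" "x = W \<tau> y" by (metis DiffD1 \<Lambda>_word_cases)
    then show "x \<in> ?A \<union> ?B" using x by (cases "\<tau> = \<omega>") auto
  next
    fix x assume "x \<in> ?A \<union> ?B"
    then show "x \<in> \<Lambda> - W \<omega> ` U"
    proof
      assume "x \<in> ?A"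
      then obtain y where y: "y \<in> \<Lambda>" "y \<notin> U" "x = W \<omega> y" by blast
      have "x \<notin> W \<omega> ` U"
      proof
        assume "x \<in> W \<omega> ` U"
        then obtain u where "u \<in> U" "W \<omega> u = W \<omega> y" using y(3) by auto
        then have "u = y"
          using inj_onD[OF word_map_inj[OF \<omega>]] U'(1) y(1) \<Lambda>_cube by blast
        then show False using y(2) \<open>u \<in> U\<close> by simp
      qed
      then show ?thesis using y word_map_in_\<Lambda>[OF \<omega>] by blast
    next
      assume "x \<in> ?B"
      then show ?thesis using disj word_map_in_\<Lambda> by blast
    qed
  qed
  moreover have "compact ?A"
    using compact_image[OF \<omega> U'(3)] \<Lambda>_cube by blast
  ultimately have "compact (\<Lambda> - W \<omega> ` U)" using compact_other_cylinders by (simp add: compact_Un)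
  moreover have "compact (W \<omega> ` U)" using compact_image[OF \<omega> U'(2)] U'(1) \<Lambda>_cube by blast
  ultimately show ?thesis
    using word_map_in_\<Lambda>[OF \<omega>] U'(1) by (auto simp: clopen_piece_def)
qed

text \<open>A clopen piece has positive distance from the rest of \<open>\<Lambda>\<close>, so small cylinders that meet it
  cannot leave it.\<close>

lemma clopen_piece_cylinders:
  assumes U: "clopen_piece \<Lambda> U"
  obtains N where "\<And>k \<omega> x y. N \<le> k \<Longrightarrow> \<omega> \<in> words D k \<Longrightarrow> x \<in> \<Lambda> \<Longrightarrow> y \<in> \<Lambda> \<Longrightarrow>
    W \<omega> x \<in> U \<Longrightarrow> W \<omega> y \<in> U"
proof -
  obtain e where e: "0 < e" "\<And>x y. x \<in> U \<Longrightarrow> y \<in> \<Lambda> \<Longrightarrow> dist x y < e \<Longrightarrow> y \<in> U"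
    using clopen_piece_separated[OF U] by blast
  obtain N where N: "\<And>k \<omega> x y. N \<le> k \<Longrightarrow> \<omega> \<in> words D k \<Longrightarrow> x \<in> \<Lambda> \<Longrightarrow> y \<in> \<Lambda> \<Longrightarrow>
    dist (W \<omega> x) (W \<omega> y) < e" using small_cylinders[OF e(1)] by blast
  show thesis
  proof (rule that)
    fix k \<omega> x y assume *: "N \<le> k" "\<omega> \<in> words D k" "x \<in> \<Lambda>" "y \<in> \<Lambda>" and U: "W \<omega> x \<in> U"
    show "W \<omega> y \<in> U" using e(2)[OF U word_map_in_\<Lambda>[OF *(2,4)] N[OF *]] .
  qed
qed

section \<open>Trivial points in the interior\<close>

text \<open>If no other cylinder of this length contains \<open>W \<omega> x\<close>, then small clopen neighbourhoods of
  \<open>x\<close> have images that avoid the other cylinders, and these images are clopen again.\<close>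

lemma trivial_point_word_map:
  assumes x: "trivial_point \<Lambda> x" and \<omega>: "\<omega> \<in> words D k"
    and alone: "\<And>\<tau>. \<tau> \<in> words D k \<Longrightarrow> \<tau> \<noteq> \<omega> \<Longrightarrow> W \<omega> x \<notin> W \<tau> ` \<Lambda>"
  shows "trivial_point \<Lambda> (W \<omega> x)"
  unfolding trivial_point_iff_clopen[OF compact_\<Lambda>]
proof (intro conjI allI impI)
  have xL: "x \<in> \<Lambda>" using x by (simp add: trivial_point_def)
  then show "W \<omega> x \<in> \<Lambda>" using word_map_in_\<Lambda>[OF \<omega>] by blast
  fix V assume V: "open V \<and> W \<omega> x \<in> V"
  let ?B = "\<Union>\<tau>\<in>words D k - {\<omega>}. W \<tau> ` \<Lambda>"
  have "open (V - ?B)" using V compact_other_cylinders by (intro open_Diff compact_imp_closed) auto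
  moreover have "W \<omega> x \<in> V - ?B" using V alone by auto
  moreover have "continuous_on \<Lambda> (W \<omega>)"
    using word_map_continuous[OF \<omega>] \<Lambda>_cube by (rule continuous_on_subset)
  ultimately obtain T where T: "open T" "x \<in> T" "\<And>y. y \<in> \<Lambda> \<Longrightarrow> y \<in> T \<Longrightarrow> W \<omega> y \<in> V - ?B"
    using xL unfolding continuous_on_topological by metis
  obtain U where U: "clopen_piece \<Lambda> U" "x \<in> U" "U \<subseteq> T"
    using x T unfolding trivial_point_iff_clopen[OF compact_\<Lambda>] by blast
  have *: "W \<omega> ` U \<subseteq> V - ?B"
  proof (rule image_subsetI)
    fix y assume "y \<in> U"
    then have "y \<in> \<Lambda>" "y \<in> T" using U(1,3) by (auto simp: clopen_piece_def)
    then show "W \<omega> y \<in> V - ?B" by (rule T(3))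
  qed
  have "clopen_piece \<Lambda> (W \<omega> ` U)"
    by (rule clopen_piece_word_map[OF \<omega> U(1)]) (use * in blast)
  with * U(2) show "\<exists>U. clopen_piece \<Lambda> U \<and> W \<omega> x \<in> U \<and> U \<subseteq> V" by blast
qed

text \<open>Among trivial points let \<open>x\<close> lie on the fewest faces. As soon as \<open>W \<omega>\<close> moves \<open>x\<close> away from one
  of its faces, \<open>W \<omega> x\<close> lies on fewer faces, hence is not trivial.\<close>

lemma neighbour_exists:
  assumes x: "trivial_point \<Lambda> x"
    and min: "\<forall>y. trivial_point \<Lambda> y \<longrightarrow> card (bd x) \<le> card (bd y)"
    and \<omega>: "\<omega> \<in> words D k" and i: "i \<in> bd x" "W \<omega> x $ i \<noteq> x $ i"
  obtains \<tau> y where "\<tau> \<in> words D k" "y \<in> \<Lambda>" "\<tau> \<noteq> \<omega>" "W \<omega> x = W \<tau> y"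
proof -
  have xL: "x \<in> \<Lambda>" using x by (simp add: trivial_point_def)
  have "bd (W \<omega> x) \<subset> bd x" using bd_word_map[OF \<omega> xL] i by blast
  then have "card (bd (W \<omega> x)) < card (bd x)" by (simp add: psubset_card_mono)
  then have "\<not> trivial_point \<Lambda> (W \<omega> x)" using min by force
  then show thesis using trivial_point_word_map[OF x \<omega>] that by blast
qed

text \<open>Suppose that \<open>x\<close> lies on a face. Let \<open>U\<close> be a clopen neighbourhood of \<open>x\<close> inside the unit
  ball about \<open>x\<close> and \<open>k\<close> a length for which cylinders that meet \<open>U\<close> stay in \<open>U\<close>. Consider the words
  of length \<open>k\<close> that agree with a coding \<open>\<beta>\<close> of \<open>x\<close> in all coordinates outside \<open>bd x\<close>.

  The cylinder of one of them is not in \<open>U\<close>: choose a digit \<open>a\<close> that moves \<open>x\<close> off a face. The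
  copy of \<open>x\<close> under \<open>a # \<beta>\<close> has a neighbour \<open>c # d\<close>, which touches it across a face, and
  after the first letter is removed the common point becomes a point of the cylinder of \<open>d\<close> on
  the face opposite to one that contains \<open>x\<close>.

  Among the words with a cylinder outside \<open>U\<close>, the one closest to the faces of \<open>x\<close> has no closer
  neighbour outside \<open>U\<close>, and a neighbour in \<open>U\<close> would force its own cylinder into \<open>U\<close>. So it has no
  neighbour at all and must be \<open>\<beta>\<close> itself, whose cylinder contains \<open>x\<close>.\<close>

lemma bd_empty_if_minimal:
  assumes x: "trivial_point \<Lambda> x"
    and min: "\<forall>y. trivial_point \<Lambda> y \<longrightarrow> card (bd x) \<le> card (bd y)"
  shows "bd x = {}"
proof (rule ccontr)
  assume "bd x \<noteq> {}"
  then obtain i0 where i0: "i0 \<in> bd x" by blast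
  have xL: "x \<in> \<Lambda>" using x by (simp add: trivial_point_def)
  note neighbour = neighbour_exists[OF x min]
  have bdx: "x $ i \<in> {0, 1}" if "i \<in> bd x" for i using that by (simp add: bd_def)
  obtain U where U: "clopen_piece \<Lambda> U" "x \<in> U" "U \<subseteq> ball x 1"
    using x unfolding trivial_point_iff_clopen[OF compact_\<Lambda>]
    by (metis centre_in_ball open_ball zero_less_one)
  obtain k where k: "\<And>\<omega> y z. \<omega> \<in> words D k \<Longrightarrow> y \<in> \<Lambda> \<Longrightarrow> z \<in> \<Lambda> \<Longrightarrow> W \<omega> y \<in> U \<Longrightarrow> W \<omega> z \<in> U"
    using clopen_piece_cylinders[OF U(1)] by (metis order_refl)
  obtain \<beta> z where \<beta>: "\<beta> \<in> words D k" and z: "z \<in> \<Lambda>" "x = W \<beta> z" using \<Lambda>_word_cases[OF xL] .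
  have \<beta>_fix: "W \<beta> x $ i = x $ i" if "i \<in> bd x" for i
  proof -
    have "z $ i = x $ i" using bd_word_map(2)[OF \<beta> z(1), of i] that z(2) by simp
    then have "W \<beta> x $ i = W \<beta> z $ i" by (simp add: word_map_nth)
    then show ?thesis using z(2) by simp
  qed

  \<comment> \<open>a word that agrees with \<open>\<beta>\<close> outside \<open>bd x\<close> and whose cylinder reaches a face opposite to \<open>x\<close>\<close>
  obtain d y i1 where d: "d \<in> words D k" "\<And>i. i \<notin> bd x \<Longrightarrow> coord_word i d = coord_word i \<beta>"
    and y: "y \<in> \<Lambda>" and i1: "W d y $ i1 = 1 - x $ i1" "i1 \<in> bd x"
  proof -
    have "\<exists>a\<in>D. W [a] x $ i0 \<noteq> x $ i0"
    proof (rule ccontr)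
      assume *: "\<not> ?thesis"
      obtain a b where ab: "a \<in> D" "b \<in> D" "a $ i0 \<noteq> b $ i0"
        using i0 by (auto simp: bd_def moving_def)
      have w: "[a] \<in> words D 1" "[b] \<in> words D 1" using ab by (auto simp: words_def)
      have "coord_map \<phi> i0 [a $ i0] (x $ i0) = coord_map \<phi> i0 [b $ i0] (x $ i0)"
        using * ab by (auto simp: slice_map_def)
      then have "x $ i0 = 1 - x $ i0"
        using coord_map_meet[OF slicing, of "[a $ i0]" "[b $ i0]" i0 "x $ i0" "x $ i0"] ab(3)
          coord_word_letters[OF w(1), of i0] coord_word_letters[OF w(2), of i0] \<Lambda>_unit[OF xL, of i0]
        by auto
      then show False using bdx[OF i0] by auto
    qed
    then obtain a where a: "a \<in> D" "W [a] x $ i0 \<noteq> x $ i0" by blast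
    have a\<beta>: "a # \<beta> \<in> words D (Suc k)" using a(1) \<beta> by (simp add: words_Cons)
    have "W (a # \<beta>) x $ i0 \<noteq> x $ i0"
      using a(2) \<beta>_fix[OF i0] by (simp add: slice_map_def)
    from neighbour[OF a\<beta> i0 this] obtain \<tau> y where \<tau>: "\<tau> \<in> words D (Suc k)" "y \<in> \<Lambda>" "\<tau> \<noteq> a # \<beta>"
      "W (a # \<beta>) x = W \<tau> y" by blast
    then obtain c d where cd: "\<tau> = c # d" by (auto simp: words_def length_Suc_conv)
    have c: "c \<in> D" and d: "d \<in> words D k" using \<tau>(1) by (simp_all add: cd words_Cons)
    note meet = cylinders_meet[OF a\<beta> \<tau>(1) xL \<tau>(2,4)]
    have off: "coord_word i d = coord_word i \<beta>" if "i \<notin> bd x" for i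
    proof -
      have "coord_word i (a # \<beta>) = coord_word i \<tau>" using meet(1)[of i] that by blast
      then show ?thesis by (simp add: cd)
    qed
    have xy: "slice_map \<phi> a (W \<beta> x) = slice_map \<phi> c (W d y)" using \<tau>(4) by (simp add: cd)
    \<comment> \<open>a neighbour in the same first-level cylinder is impossible: it would put \<open>y\<close> both on the
      face of \<open>x\<close> and on the opposite one\<close>
    have "\<exists>i\<in>bd x. W d y $ i = 1 - x $ i"
    proof (cases "c = a")
      case True
      have a1: "[a] \<in> words D 1" using a by (simp add: words_def)
      have "W \<beta> x = W d y"
      proof (rule inj_onD[OF word_map_inj[OF a1]])
        show "W [a] (W \<beta> x) = W [a] (W d y)" using xy True by simp
      qed (use word_map_in_\<Lambda>[OF \<beta> xL] word_map_in_\<Lambda>[OF d \<tau>(2)] \<Lambda>_cube in auto)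
      moreover have "\<beta> \<noteq> d" using \<tau>(3) True by (simp add: cd)
      then obtain i where i: "coord_word i \<beta> \<noteq> coord_word i d" using words_eqI by blast
      ultimately have 1: "i \<in> bd x" "y $ i = 1 - x $ i"
        using cylinders_meet[OF \<beta> d xL \<tau>(2)] by auto
      have "W d y $ i = x $ i" using \<open>W \<beta> x = W d y\<close> \<beta>_fix[OF 1(1)] by simp
      then have "y $ i = x $ i"
        using coord_map_endpoint[OF slicing coord_word_letters[OF d] \<Lambda>_unit[OF \<tau>(2)] bdx[OF 1(1)]]
        by (simp add: word_map_nth)
      then show ?thesis using 1 bdx[OF 1(1)] by auto
    next
      case False
      then obtain i where i: "a $ i \<noteq> c $ i" by (metis vec_eq_iff)
      then have b: "i \<in> bd x" using meet(1)[of i] by (simp add: cd)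
      have w: "[a] \<in> words D 1" "[c] \<in> words D 1" using a(1) c by (auto simp: words_def)
      have "\<phi> (a $ i) i (W \<beta> x $ i) = \<phi> (c $ i) i (W d y $ i)"
        using xy by (simp add: slice_map_def vec_eq_iff)
      then have "W d y $ i = 1 - W \<beta> x $ i"
        using coord_map_meet[OF slicing, of "[a $ i]" "[c $ i]" i "W \<beta> x $ i" "W d y $ i"] i
          coord_word_letters[OF w(1), of i] coord_word_letters[OF w(2), of i]
          \<Lambda>_unit[OF word_map_in_\<Lambda>[OF \<beta> xL], of i] \<Lambda>_unit[OF word_map_in_\<Lambda>[OF d \<tau>(2)], of i]
        by auto
      then show ?thesis using \<beta>_fix[OF b] b by auto
    qed
    then show thesis using that[OF d off \<tau>(2)] by blast
  qed
  have "W d y \<notin> U"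
  proof
    assume "W d y \<in> U"
    then have "dist x (W d y) < 1" using U(3) by auto
    moreover have "\<bar>(x - W d y) $ i1\<bar> \<le> dist x (W d y)"
      unfolding dist_norm by (rule component_le_norm_cart)
    ultimately show False using i1 bdx[OF i1(2)] by auto
  qed

  \<comment> \<open>minimising the distance \<open>g\<close> to the faces of \<open>x\<close> replaces walking along the chain\<close>
  define B where "B = {\<omega> \<in> words D k. (\<forall>i. i \<notin> bd x \<longrightarrow> coord_word i \<omega> = coord_word i \<beta>) \<and>
    (\<exists>y\<in>\<Lambda>. W \<omega> y \<notin> U)}"
  define g where "g \<omega> = (\<Sum>i\<in>bd x. \<bar>W \<omega> x $ i - x $ i\<bar>)" for \<omega>
  have "d \<in> B" using d y \<open>W d y \<notin> U\<close> unfolding B_def by blast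
  moreover have "finite B" using finite_words[of k] by (rule finite_subset[rotated]) (auto simp: B_def)
  ultimately obtain \<omega> where "is_arg_min g (\<lambda>\<omega>. \<omega> \<in> B) \<omega>"
    using ex_is_arg_min_if_finite[of B g] by blast
  then have \<omega>B: "\<omega> \<in> B" and least: "\<And>\<tau>. \<tau> \<in> B \<Longrightarrow> \<not> g \<tau> < g \<omega>" by (auto simp: is_arg_min_def)
  have \<omega>: "\<omega> \<in> words D k" "\<And>i. i \<notin> bd x \<Longrightarrow> coord_word i \<omega> = coord_word i \<beta>"
    and out: "W \<omega> v \<notin> U" if "v \<in> \<Lambda>" for v
    using \<omega>B k that unfolding B_def by blast+
  show False
  proof (cases "\<exists>i\<in>bd x. W \<omega> x $ i \<noteq> x $ i")
    case True
    then obtain i where i: "i \<in> bd x" "W \<omega> x $ i \<noteq> x $ i" by blast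
    from neighbour[OF \<omega>(1)[OF xL] i] obtain \<tau> v where \<tau>: "\<tau> \<in> words D k" "v \<in> \<Lambda>" "\<tau> \<noteq> \<omega>"
      "W \<omega> x = W \<tau> v" by blast
    note meet = cylinders_meet[OF \<omega>(1)[OF xL] \<tau>(1) xL \<tau>(2,4)]
    have "coord_word i \<tau> = coord_word i \<beta>" if "i \<notin> bd x" for i
    proof -
      have "coord_word i \<omega> = coord_word i \<tau>" using meet(1)[of i] that by blast
      then show ?thesis using \<omega>(2)[OF xL that] by simp
    qed
    moreover have "W \<tau> v \<notin> U" using out[OF xL] \<tau>(4) by simp
    ultimately have "\<tau> \<in> B" using \<tau> unfolding B_def by blast
    \<comment> \<open>where the words differ, \<open>v\<close> sits on the side opposite to \<open>x\<close>, so the cylinder of \<open>\<tau>\<close>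
      lies closer to the face of \<open>x\<close>\<close>
    have closer: "\<bar>W \<tau> x $ i - x $ i\<bar> < \<bar>W \<omega> x $ i - x $ i\<bar>"
      if "coord_word i \<omega> \<noteq> coord_word i \<tau>" for i
    proof -
      have v: "i \<in> bd x" "v $ i = 1 - x $ i" using meet[OF that] by auto
      have eq: "W \<omega> x $ i = coord_map \<phi> i (coord_word i \<tau>) (v $ i)"
        using \<tau>(4) by (simp add: word_map_nth[symmetric])
      have m: "p < q \<Longrightarrow> coord_map \<phi> i (coord_word i \<tau>) p < coord_map \<phi> i (coord_word i \<tau>) q"
        if "p \<in> {0..1}" "q \<in> {0..1}" for p q
        using coord_map_strict_mono[OF slicing coord_word_letters[OF \<tau>(1)] that] .
      have eq': "W \<tau> x $ i = coord_map \<phi> i (coord_word i \<tau>) (x $ i)" by (rule word_map_nth)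
      have "W \<tau> x $ i \<in> {0..1}" using \<Lambda>_unit word_map_in_\<Lambda>[OF \<tau>(1) xL] by blast
      then show ?thesis
        using bdx[OF v(1)] v(2) m[of 0 1] unfolding eq eq' by auto
    qed
    have "\<bar>W \<tau> x $ i - x $ i\<bar> \<le> \<bar>W \<omega> x $ i - x $ i\<bar>" for i
      using closer[of i] by (cases "coord_word i \<omega> = coord_word i \<tau>") (simp_all add: word_map_nth)
    moreover obtain j where "coord_word j \<omega> \<noteq> coord_word j \<tau>" using words_eqI \<tau>(3) by metis
    then have "j \<in> bd x" "\<bar>W \<tau> x $ j - x $ j\<bar> < \<bar>W \<omega> x $ j - x $ j\<bar>"
      using meet(1) closer by blast+
    ultimately have "g \<tau> < g \<omega>" unfolding g_def by (intro sum_strict_mono_ex1) auto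
    with least[OF \<open>\<tau> \<in> B\<close>] show False by simp
  next
    case False
    have "coord_word i \<omega> = coord_word i \<beta>" for i
    proof (cases "i \<in> bd x")
      case True
      show ?thesis
      proof (rule ccontr)
        assume diff: "coord_word i \<omega> \<noteq> coord_word i \<beta>"
        have "coord_map \<phi> i (coord_word i \<omega>) (x $ i) = coord_map \<phi> i (coord_word i \<beta>) (x $ i)"
          using False True \<beta>_fix[OF True] by (simp add: word_map_nth)
        then have "x $ i = 1 - x $ i"
          using coord_map_meet[OF slicing _ coord_word_letters[OF \<omega>(1)[OF xL]]
              coord_word_letters[OF \<beta>] \<Lambda>_unit[OF xL] \<Lambda>_unit[OF xL] _ diff]
            \<omega>(1)[OF xL] \<beta> by (simp add: words_def)
        then show False using bdx[OF True] by auto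
      qed
    next
      case False
      then show ?thesis using \<omega>(2)[OF xL] by blast
    qed
    then have "\<omega> = \<beta>" by (rule words_eqI)
    then show False using out[OF z(1)] z(2) U(2) by simp
  qed
qed

lemma interior_clopen_piece:
  assumes "\<exists>x. trivial_point \<Lambda> x"
  obtains U where "clopen_piece \<Lambda> U" "U \<noteq> {}" "\<And>y. y \<in> U \<Longrightarrow> bd y = {}"
proof -
  obtain x where x: "trivial_point \<Lambda> x" "\<forall>y. trivial_point \<Lambda> y \<longrightarrow> card (bd x) \<le> card (bd y)"
    using ex_has_least_nat[of "trivial_point \<Lambda>" _ "\<lambda>x. card (bd x)"] assms by blast
  then have "bd x = {}" by (rule bd_empty_if_minimal)
  define V where "V = (\<Inter>i\<in>moving. {y :: real ^ 'd. y $ i \<noteq> 0 \<and> y $ i \<noteq> 1})"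
  have "open {y :: real ^ 'd. y $ i \<noteq> 0 \<and> y $ i \<noteq> 1}" for i
    by (intro open_Collect_conj open_Collect_neq continuous_intros)
  then have "open V" unfolding V_def by (intro open_INT) auto
  moreover have "x \<in> V" using \<open>bd x = {}\<close> by (auto simp: V_def bd_def)
  ultimately obtain U where "clopen_piece \<Lambda> U" "x \<in> U" "U \<subseteq> V"
    using x(1) unfolding trivial_point_iff_clopen[OF compact_\<Lambda>] by blast
  then show thesis using that[of U] by (auto simp: V_def bd_def)
qed

lemma clopen_piece_word_map_interior:
  assumes "clopen_piece \<Lambda> U" "\<And>y. y \<in> U \<Longrightarrow> bd y = {}" "\<omega> \<in> words D k"
  shows "clopen_piece \<Lambda> (W \<omega> ` U)"
proof (rule clopen_piece_word_map[OF assms(3,1)])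
  fix \<tau> assume \<tau>: "\<tau> \<in> words D k" "\<tau> \<noteq> \<omega>"
  show "W \<omega> ` U \<inter> W \<tau> ` \<Lambda> = {}"
  proof (rule ccontr)
    assume "W \<omega> ` U \<inter> W \<tau> ` \<Lambda> \<noteq> {}"
    then obtain u y where uy: "u \<in> U" "y \<in> \<Lambda>" "W \<omega> u = W \<tau> y" by auto
    obtain i where "coord_word i \<omega> \<noteq> coord_word i \<tau>" using words_eqI \<tau>(2) by metis
    then have "i \<in> bd u"
      using cylinders_meet(1)[OF assms(3) \<tau>(1) _ uy(2,3)] uy(1) assms(1)
      by (auto simp: clopen_piece_def)
    then show False using assms(2)[OF uy(1)] by simp
  qed
qed

section \<open>Omitting an interior clopen cylinder\<close>

text \<open>The copies of \<open>U\<close> in long cylinders are clopen and small.\<close>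

lemma trivial_point_if_deep:
  assumes U: "clopen_piece \<Lambda> U" "\<And>y. y \<in> U \<Longrightarrow> bd y = {}"
    and deep: "\<And>N. \<exists>k\<ge>N. \<exists>\<omega>\<in>words D k. x \<in> W \<omega> ` U"
  shows "trivial_point \<Lambda> x"
  unfolding trivial_point_iff_clopen[OF compact_\<Lambda>]
proof (intro conjI allI impI)
  have UL: "U \<subseteq> \<Lambda>" using U(1) by (simp add: clopen_piece_def)
  show "x \<in> \<Lambda>" using deep[of 0] UL word_map_in_\<Lambda> by blast
  fix V assume V: "open V \<and> x \<in> V"
  then obtain e where e: "0 < e" "ball x e \<subseteq> V" using open_contains_ball by blast
  obtain N where N: "\<And>k \<omega> x y. N \<le> k \<Longrightarrow> \<omega> \<in> words D k \<Longrightarrow> x \<in> \<Lambda> \<Longrightarrow> y \<in> \<Lambda> \<Longrightarrow>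
    dist (W \<omega> x) (W \<omega> y) < e" using small_cylinders[OF e(1)] by blast
  obtain k \<omega> u where \<omega>: "N \<le> k" "\<omega> \<in> words D k" "u \<in> U" "x = W \<omega> u" using deep by blast
  have "W \<omega> ` U \<subseteq> ball x e"
  proof (rule image_subsetI)
    fix y assume "y \<in> U"
    then have "dist (W \<omega> u) (W \<omega> y) < e" using N[OF \<omega>(1,2)] UL \<omega>(3) by blast
    then show "W \<omega> y \<in> ball x e" by (simp add: \<omega>(4))
  qed
  then show "\<exists>U. clopen_piece \<Lambda> U \<and> x \<in> U \<and> U \<subseteq> V"
    using clopen_piece_word_map_interior[OF U \<omega>(2)] \<omega>(3,4) e(2) by blast
qed

lemma connected_part_not_trivial: "x \<in> connected_part S \<Longrightarrow> \<not> trivial_point S x"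
proof
  assume x: "x \<in> connected_part S" "trivial_point S x"
  then obtain C where C: "C \<in> components S" "\<not> is_singleton C" "x \<in> C"
    by (auto simp: connected_part_def)
  then have "C = connected_component_set S x"
    by (metis components_iff connected_component_eq)
  then show False using C(2) x(2) by (simp add: trivial_point_def)
qed

lemma connected_part_covered:
  assumes card: "2 \<le> card D" and triv: "\<exists>x. trivial_point \<Lambda> x"
  shows "\<exists>m\<ge>1. \<exists>D' \<Lambda>'. D' \<subset> words D m \<and> is_attractor W D' \<Lambda>' \<and>
    connected_part \<Lambda> \<subseteq> (\<Union>\<omega>\<in>(\<Union>k. words D k). W \<omega> ` \<Lambda>')"
proof -
  obtain U where U: "clopen_piece \<Lambda> U" "U \<noteq> {}" "\<And>y. y \<in> U \<Longrightarrow> bd y = {}"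
    using interior_clopen_piece[OF triv] by blast
  have UL: "U \<subseteq> \<Lambda>" using U(1) by (simp add: clopen_piece_def)
  obtain N where N: "\<And>k \<omega> x y. N \<le> k \<Longrightarrow> \<omega> \<in> words D k \<Longrightarrow> x \<in> \<Lambda> \<Longrightarrow> y \<in> \<Lambda> \<Longrightarrow>
    W \<omega> x \<in> U \<Longrightarrow> W \<omega> y \<in> U" using clopen_piece_cylinders[OF U(1)] by blast
  define m where "m = Suc N"
  obtain p where "p \<in> U" using U(2) by blast
  then obtain \<sigma> q where \<sigma>: "\<sigma> \<in> words D m" "q \<in> \<Lambda>" "p = W \<sigma> q"
    using UL \<Lambda>_word_cases by (metis subsetD)
  have \<sigma>U: "W \<sigma> y \<in> U" if "y \<in> \<Lambda>" for y
    using N[of m \<sigma> q y] \<sigma> \<open>p \<in> U\<close> that by (simp add: m_def)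
  define D' where "D' = words D m - {\<sigma>}"
  have proper: "D' \<subset> words D m" using \<sigma>(1) by (auto simp: D'_def)
  have "D' \<noteq> {}"
  proof -
    obtain s \<sigma>' where s: "\<sigma> = s # \<sigma>'" using \<sigma>(1) by (auto simp: words_def m_def length_Suc_conv)
    \<comment> \<open>change the first letter of \<open>\<sigma>\<close>\<close>
    have "card (D - {s}) \<noteq> 0" using card by (simp add: card_Diff_singleton_if)
    then obtain b where "b \<in> D" "b \<noteq> s" by (metis Diff_iff card_eq_0_iff ex_in_conv insertCI)
    then have "b # \<sigma>' \<in> D'" using \<sigma>(1) by (auto simp: D'_def s words_def)
    then show ?thesis by blast
  qed
  define \<Lambda>' where "\<Lambda>' = (\<Inter>k. (hutchinson W D' ^^ k) unit_cube)"
  have "finite D'" using finite_words by (simp add: D'_def)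
  then have attr: "is_attractor W D' \<Lambda>'"
    unfolding \<Lambda>'_def
  proof (rule is_attractor_Inter_iterates[OF _ \<open>D' \<noteq> {}\<close>])
    fix \<omega> assume "\<omega> \<in> D'"
    then have \<omega>: "\<omega> \<in> words D m" using proper by blast
    show "continuous_on unit_cube (W \<omega>)" "inj_on (W \<omega>) unit_cube" "W \<omega> ` unit_cube \<subseteq> unit_cube"
      using word_map_continuous[OF \<omega>] word_map_inj[OF \<omega>] word_map_cube[OF \<omega>] .
  qed

  \<comment> \<open>a point outside \<open>\<Lambda>'\<close> reads \<open>\<sigma>\<close> at some block of its coding, hence lies in an image of \<open>U\<close>\<close>
  have escape: "\<exists>k. \<exists>v\<in>words D k. y \<in> W v ` U" if y: "y \<in> \<Lambda>" "y \<notin> \<Lambda>'" for y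
  proof (rule ccontr)
    assume none: "\<not> ?thesis"
    have "y \<in> (hutchinson W D' ^^ k) unit_cube"
      if "y \<in> \<Lambda>" "\<not> (\<exists>k. \<exists>v\<in>words D k. y \<in> W v ` U)" for k y
      using that
    proof (induction k arbitrary: y)
      case 0
      then show ?case using \<Lambda>_cube by auto
    next
      case (Suc k)
      obtain \<rho> z where \<rho>: "\<rho> \<in> words D m" "z \<in> \<Lambda>" "y = W \<rho> z" using \<Lambda>_word_cases[OF Suc.prems(1)] .
      have "[] \<in> words D 0" by (simp add: words_def)
      then have "y \<notin> U" using Suc.prems(2) by force
      then have "\<rho> \<in> D'" using \<rho> \<sigma>U by (auto simp: D'_def)
      moreover have "\<not> (\<exists>k. \<exists>v\<in>words D k. z \<in> W v ` U)"
      proof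
        assume "\<exists>k. \<exists>v\<in>words D k. z \<in> W v ` U"
        then obtain l v u where v: "v \<in> words D l" "u \<in> U" "z = W v u" by blast
        then have "y = W (\<rho> @ v) u" using \<rho>(3) by (simp add: word_map_append)
        then show False using Suc.prems(2) words_append[OF \<rho>(1) v(1)] v(2) by blast
      qed
      then have "z \<in> (hutchinson W D' ^^ k) unit_cube" using Suc.IH \<rho>(2) by blast
      ultimately show ?case using \<rho>(3)
        by (simp only: funpow.simps comp_apply hutchinson_def[of W D' "(hutchinson W D' ^^ k) unit_cube"])
          blast
    qed
    then have "y \<in> \<Lambda>'" using y(1) none unfolding \<Lambda>'_def by blast
    with y(2) show False by simp
  qed
  have "connected_part \<Lambda> \<subseteq> (\<Union>\<omega>\<in>(\<Union>k. words D k). W \<omega> ` \<Lambda>')"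
  proof (rule subsetI, rule ccontr)
    fix x assume x: "x \<in> connected_part \<Lambda>" and not: "x \<notin> (\<Union>\<omega>\<in>(\<Union>k. words D k). W \<omega> ` \<Lambda>')"
    have "x \<in> \<Lambda>" using x in_components_subset by (auto simp: connected_part_def)
    have "\<exists>k\<ge>M. \<exists>\<omega>\<in>words D k. x \<in> W \<omega> ` U" for M
    proof -
      obtain \<omega> y where \<omega>: "\<omega> \<in> words D M" "y \<in> \<Lambda>" "x = W \<omega> y" using \<Lambda>_word_cases[OF \<open>x \<in> \<Lambda>\<close>] .
      then have "y \<notin> \<Lambda>'" using not by blast
      then obtain l v u where v: "v \<in> words D l" "u \<in> U" "y = W v u" using escape[OF \<omega>(2)] by blast
      then have "x = W (\<omega> @ v) u" using \<omega>(3) by (simp add: word_map_append)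
      then show ?thesis using words_append[OF \<omega>(1) v(1)] v(2) by (metis imageI le_add1)
    qed
    then have "trivial_point \<Lambda> x" using trivial_point_if_deep[OF U(1,3)] by blast
    with connected_part_not_trivial[OF x] show False by blast
  qed
  moreover have "1 \<le> m" by (simp add: m_def)
  ultimately show ?thesis using proper attr by blast
qed

end

theorem theorem1p3:
  fixes n :: "'d::finite \<Rightarrow> nat"
    and \<phi> :: "nat \<Rightarrow> 'd \<Rightarrow> real \<Rightarrow> real"
    and D :: "(nat ^ 'd) set"
    and \<Lambda> :: "(real ^ 'd) set"
  assumes "slicing n \<phi>"
    and "D \<subseteq> digits n"
    and "card D \<ge> 2"
    and "is_attractor (slice_map \<phi>) D \<Lambda>"
    and "\<exists>x. trivial_point \<Lambda> x"
  shows "\<exists>m\<ge>1. \<exists>D' \<Lambda>'. D' \<subset> words D m \<and> is_attractor (word_map \<phi>) D' \<Lambda>' \<and>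
           connected_part \<Lambda> \<subseteq> (\<Union>\<omega>\<in>(\<Union>k. words D k). word_map \<phi> \<omega> ` \<Lambda>')"
proof -
  have "finite D" using \<open>card D \<ge> 2\<close> card.infinite by fastforce
  then interpret slicing_sponge n \<phi> D \<Lambda> using assms by unfold_locales
  show ?thesis using assms(3,5) by (rule connected_part_covered)
qed

end
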